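(* Let $\mathbf v=(a,b,c,d)$ be any root quadruple with $a\le b\le c\le d$ and $a<0$, $a+b+c+d>0$. Then for any reduced word $W$ of length $n$ in the generators $\{S_1,S_2,S_3,S_4\}$ of the Apollonian group, $$\|W\mathbf v\|_\infty\le\|T_n\mathbf v\|_\infty,$$ where, writing $n=4m+i$ with $0\le i\le3$, $T_n:=T_i(S_4S_3S_2S_1)^m$, with $T_0=I$, $T_1=S_1$, $T_2=S_2S_1$, $T_3=S_3S_2S_1$.
   Context: A Descartes quadruple is $(a,b,c,d)\in\mathbb R^4$ with $2(a^2+b^2+c^2+d^2)=(a+b+c+d)^2$. A Descartes quadruple with $a+b+c+d>0$ is a root quadruple if $a\le0\le b\le c\le d$ and $a+b+c\ge d$. For $1\le i\le4$, $S_i$ is the $4\times4$ matrix that sends a column vector $(v_1,v_2,v_3,v_4)^T$ to the vector with $v_i$ replaced by $2\sum_{j\ne i}v_j-v_i$ and other entries unchanged; these generate the Apollonian group. A reduced word of length $n$ is a product $S_{i_n}S_{i_{n-1}}\cdots S_{i_1}$ with $i_{k}\ne i_{k+1}$ for $1\le k<n$. Words act on $\mathbf v$ regarded as a column vector, and $\|\mathbf w\|_\infty=\max_{1\le i\le4}|w_i|$. *)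

theory Defs
  imports "HOL-Analysis.Analysis"
begin

definition descartes_quadruple :: "real ^ 4 \<Rightarrow> bool" where
  "descartes_quadruple v \<longleftrightarrow>
     2 * ((v $ 1)\<^sup>2 + (v $ 2)\<^sup>2 + (v $ 3)\<^sup>2 + (v $ 4)\<^sup>2)
       = (v $ 1 + v $ 2 + v $ 3 + v $ 4)\<^sup>2"

definition root_quadruple :: "real ^ 4 \<Rightarrow> bool" where
  "root_quadruple v \<longleftrightarrow>
     descartes_quadruple v \<and> v $ 1 + v $ 2 + v $ 3 + v $ 4 > 0 \<and>
     v $ 1 \<le> 0 \<and> 0 \<le> v $ 2 \<and> v $ 2 \<le> v $ 3 \<and> v $ 3 \<le> v $ 4 \<and>
     v $ 1 + v $ 2 + v $ 3 \<ge> v $ 4"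

definition apollonian_gen :: "4 \<Rightarrow> real ^ 4 ^ 4" where
  "apollonian_gen i =
     (\<chi> r c. if r = i then (if c = i then - 1 else 2) else (if c = r then 1 else 0))"

lemma apollonian_gen_mult_vec:
  "apollonian_gen i *v v =
     (\<chi> j. if j = i then 2 * (\<Sum>k\<in>UNIV - {i}. v $ k) - v $ i else v $ j)"
proof -
  have 1: "(\<Sum>c\<in>UNIV. (if c = i then - 1 else 2) * v $ c)
      = 2 * (\<Sum>k\<in>UNIV - {i}. v $ k) - v $ i"
    by (subst sum.remove[of _ i]) (auto simp: sum_distrib_left intro!: sum.cong)
  have 2: "(\<Sum>c\<in>UNIV. (if c = j then 1 else 0) * v $ c) = v $ j" for j
    by (simp add: if_distrib[of "\<lambda>x. x * _"] cong: if_cong)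
  show ?thesis
    by (simp add: vec_eq_iff matrix_vector_mult_def apollonian_gen_def 1 2)
qed

(* The list [i_1, ..., i_n] denotes the product S_{i_n} ** ... ** S_{i_1}:
   the head of the list is the rightmost factor, i.e. it acts first. *)
primrec word_matrix :: "4 list \<Rightarrow> real ^ 4 ^ 4" where
  "word_matrix [] = mat 1"
| "word_matrix (i # is) = word_matrix is ** apollonian_gen i"

definition reduced_word :: "nat \<Rightarrow> real ^ 4 ^ 4 \<Rightarrow> bool" where
  "reduced_word n W \<longleftrightarrow>
     (\<exists>is. length is = n \<and> (\<forall>k. Suc k < n \<longrightarrow> is ! k \<noteq> is ! Suc k) \<and> W = word_matrix is)"

(* The overloaded power on real ^ 4 ^ 4 is entrywise, hence not usable here. *)
primrec matrix_power :: "real ^ 4 ^ 4 \<Rightarrow> nat \<Rightarrow> real ^ 4 ^ 4" where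
  "matrix_power A 0 = mat 1"
| "matrix_power A (Suc m) = A ** matrix_power A m"

definition T_init :: "nat \<Rightarrow> real ^ 4 ^ 4" where
  "T_init i =
     (if i = 0 then mat 1
      else if i = 1 then apollonian_gen 1
      else if i = 2 then apollonian_gen 2 ** apollonian_gen 1
      else apollonian_gen 3 ** apollonian_gen 2 ** apollonian_gen 1)"

definition T_word :: "nat \<Rightarrow> real ^ 4 ^ 4" where
  "T_word n = T_init (n mod 4) **
     matrix_power (apollonian_gen 4 ** apollonian_gen 3 ** apollonian_gen 2 ** apollonian_gen 1)
       (n div 4)"

lemma infnorm_eq_Max_abs: "infnorm (w :: real ^ 4) = Max {\<bar>w $ i\<bar> | i. i \<in> UNIV}"
  unfolding infnorm_cart by (rule cSup_eq_Max) (auto simp: full_SetCompr_eq)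

end

theory Submission
  imports Defs
begin

text \<open>
  Along \<open>T\<^sub>n\<close> the smallest entry is always the one replaced, so the entries of
  \<open>T\<^sub>n v\<close> are four consecutive terms of a linear recurrence. For an arbitrary reduced word, the
  letter just applied sits at the largest entry, and the word must next replace one of the other
  three. Passing from \<open>x\<close> to \<open>F x = (x\<^sub>2, x\<^sub>3, x\<^sub>4, 2(x\<^sub>2 + x\<^sub>3 + x\<^sub>4) - x\<^sub>1)\<close> is not monotone
  in the entrywise order on sorted quadruples, but it is monotone in the order given by the cone
  of all \<open>z \<ge> 0\<close> with \<open>z\<^sub>1 \<le> z\<^sub>4\<close>. This cone also contains the difference between \<open>F x\<close> and the
  sorted result of replacing any other entry, so \<open>T\<^sub>n v\<close> dominates every \<open>W v\<close>.
\<close>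

lemma apollonian_gen_nth:
  "(apollonian_gen k *v w) $ j =
     (if j = k then 2 * (\<Sum>i\<in>UNIV. w $ i) - 3 * w $ k else w $ j)"
  by (simp add: apollonian_gen_mult_vec sum_diff1)

fun greedy_seq :: "real ^ 4 \<Rightarrow> nat \<Rightarrow> real" where
  "greedy_seq v 0 = v $ 1"
| "greedy_seq v (Suc 0) = v $ 2"
| "greedy_seq v (Suc (Suc 0)) = v $ 3"
| "greedy_seq v (Suc (Suc (Suc 0))) = v $ 4"
| "greedy_seq v (Suc (Suc (Suc (Suc n)))) =
     2 * (greedy_seq v (Suc n) + greedy_seq v (Suc (Suc n)) + greedy_seq v (Suc (Suc (Suc n))))
       - greedy_seq v n"

text \<open>One full cycle overwrites coordinates 1, 2, 3, 4 in turn, always the oldest of the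
  current four terms, so the window returns to its original alignment, shifted by four.\<close>

lemma matrix_power_greedy_seq:
  fixes v :: "real ^ 4" and m :: nat
  defines "w \<equiv> matrix_power
    (apollonian_gen 4 ** apollonian_gen 3 ** apollonian_gen 2 ** apollonian_gen 1) m *v v"
  shows "w $ 1 = greedy_seq v (4 * m) \<and> w $ 2 = greedy_seq v (Suc (4 * m)) \<and>
    w $ 3 = greedy_seq v (Suc (Suc (4 * m))) \<and> w $ 4 = greedy_seq v (Suc (Suc (Suc (4 * m))))"
  unfolding w_def
proof (induction m)
  case 0
  show ?case by simp
next
  case (Suc m)
  have "4 * Suc m = Suc (Suc (Suc (Suc (4 * m))))" by simp
  with Suc show ?case
    by (simp add: matrix_vector_mul_assoc[symmetric] apollonian_gen_nth sum_4 del: mult_Suc_right)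
qed

text \<open>After \<open>n\<close> letters the newest term has index \<open>n + 3\<close>. The
  residue \<open>n mod 4\<close> tells where it sits: in coordinate 4, 1, 2 or 3.\<close>

lemma greedy_seq_le_infnorm_T_word:
  "greedy_seq v (Suc (Suc (Suc n))) \<le> infnorm (T_word n *v v)"
proof -
  define m where "m = n div 4"
  have n: "n = 4 * m + n mod 4" by (simp add: m_def)
  have "n mod 4 < 4" by simp
  then consider "n mod 4 = 0" | "n mod 4 = 1" | "n mod 4 = 2" | "n mod 4 = 3" by linarith
  then have "\<exists>j. (T_word n *v v) $ j = greedy_seq v (Suc (Suc (Suc n)))"
  proof cases
    case 1
    then have "n = 4 * m" using n by simp
    moreover from 1 have "(T_word n *v v) $ 4 = greedy_seq v (Suc (Suc (Suc (4 * m))))"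
      using matrix_power_greedy_seq[of m v] by (simp add: T_word_def T_init_def m_def)
    ultimately show ?thesis by metis
  next
    case 2
    then have "n = Suc (4 * m)" using n by simp
    moreover from 2 have "(T_word n *v v) $ 1 = greedy_seq v (Suc (Suc (Suc (Suc (4 * m)))))"
      using matrix_power_greedy_seq[of m v]
      by (simp add: T_word_def T_init_def m_def matrix_vector_mul_assoc[symmetric]
          apollonian_gen_nth sum_4)
    ultimately show ?thesis by metis
  next
    case 3
    then have "n = Suc (Suc (4 * m))" using n by simp
    moreover from 3 have "(T_word n *v v) $ 2 = greedy_seq v (Suc (Suc (Suc (Suc (Suc (4 * m))))))"
      using matrix_power_greedy_seq[of m v]
      by (simp add: T_word_def T_init_def m_def matrix_vector_mul_assoc[symmetric]
          apollonian_gen_nth sum_4)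
    ultimately show ?thesis by metis
  next
    case 4
    then have "n = Suc (Suc (Suc (4 * m)))" using n by simp
    moreover from 4 have
      "(T_word n *v v) $ 3 = greedy_seq v (Suc (Suc (Suc (Suc (Suc (Suc (4 * m)))))))"
      using matrix_power_greedy_seq[of m v]
      by (simp add: T_word_def T_init_def m_def matrix_vector_mul_assoc[symmetric]
          apollonian_gen_nth sum_4)
    ultimately show ?thesis by metis
  qed
  then show ?thesis
    using component_le_infnorm_cart[of "T_word n *v v"] by (metis abs_ge_self order_trans)
qed

text \<open>
  The index \<open>j\<close> is that of a largest entry. The last conjunct is the condition \<open>z\<^sub>1 \<le> z\<^sub>4\<close> on the
  difference \<open>z\<close>; it subsumes \<open>z\<^sub>4 \<ge> 0\<close>.
\<close>

definition dominated :: "(nat \<Rightarrow> real) \<Rightarrow> nat \<Rightarrow> 4 \<Rightarrow> real ^ 4 \<Rightarrow> bool" where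
  "dominated u n j w \<longleftrightarrow>
     (\<exists>p q r. distinct [p, q, r, j] \<and> UNIV = {p, q, r, j} \<and>
        w $ p \<le> w $ q \<and> w $ q \<le> w $ r \<and> w $ r \<le> w $ j \<and> 0 \<le> w $ p + w $ q \<and>
        w $ p \<le> u n \<and> w $ q \<le> u (Suc n) \<and> w $ r \<le> u (Suc (Suc n)) \<and>
        u n - w $ p \<le> u (Suc (Suc (Suc n))) - w $ j)"

lemma dominatedI:
  assumes "distinct [p, q, r, j]" and "UNIV = {p, q, r, j}"
    and "w $ p \<le> w $ q" and "w $ q \<le> w $ r" and "w $ r \<le> w $ j" and "0 \<le> w $ p + w $ q"
    and "w $ p \<le> u n" and "w $ q \<le> u (Suc n)" and "w $ r \<le> u (Suc (Suc n))"
    and "u n - w $ p \<le> u (Suc (Suc (Suc n))) - w $ j"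
  shows "dominated u n j w"
  unfolding dominated_def using assms by blast

text \<open>Only \<open>w $ p\<close> can be negative, and \<open>0 \<le> w $ p + w $ q\<close>
  bounds its absolute value by \<open>w $ q\<close>. So \<open>w $ j\<close> is the norm, and the
  first and last bounds together control it.\<close>

lemma dominated_infnorm:
  assumes "dominated u n j w"
  shows "infnorm w \<le> u (Suc (Suc (Suc n)))"
proof -
  from assms obtain p q r where *: "UNIV = {p, q, r, j}" "w $ p \<le> w $ q" "w $ q \<le> w $ r"
    "w $ r \<le> w $ j" "0 \<le> w $ p + w $ q" "w $ p \<le> u n"
    "u n - w $ p \<le> u (Suc (Suc (Suc n))) - w $ j"
    unfolding dominated_def by blast
  have "\<bar>w $ i\<bar> \<le> u (Suc (Suc (Suc n)))" for i
  proof -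
    have "i \<in> {p, q, r, j}" using *(1) by blast
    then show ?thesis using *(2-) by auto
  qed
  then show ?thesis by (auto simp: infnorm_cart intro!: cSup_least)
qed

text \<open>In every case the new entry is the largest, so the sorted order is the three kept
  entries followed by \<open>k\<close>. For \<open>k = j\<close> this needs the second alternative
  of the last hypothesis.\<close>

lemma dominated_step:
  assumes dom: "dominated u n j w"
    and rec: "u (Suc (Suc (Suc (Suc n)))) =
      2 * (u (Suc n) + u (Suc (Suc n)) + u (Suc (Suc (Suc n)))) - u n"
    and k: "k \<noteq> j \<or> 2 * w $ j \<le> (\<Sum>i\<in>UNIV. w $ i)"
  shows "dominated u (Suc n) k (apollonian_gen k *v w)"
proof -
  from dom obtain p q r where d: "distinct [p, q, r, j]" and U: "UNIV = {p, q, r, j}"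
    and w: "w $ p \<le> w $ q" "w $ q \<le> w $ r" "w $ r \<le> w $ j" "0 \<le> w $ p + w $ q" "w $ p \<le> u n"
    "w $ q \<le> u (Suc n)" "w $ r \<le> u (Suc (Suc n))" "u n - w $ p \<le> u (Suc (Suc (Suc n))) - w $ j"
    unfolding dominated_def by blast
  have s: "(\<Sum>i\<in>UNIV. w $ i) = w $ p + w $ q + w $ r + w $ j"
    unfolding U using d by simp
  have ne: "p \<noteq> q" "p \<noteq> r" "p \<noteq> j" "q \<noteq> r" "q \<noteq> j" "r \<noteq> j"
    using d by simp_all
  note ne = ne ne[symmetric]
  have "k \<in> {p, q, r, j}" using U by blast
  then consider "k = p" | "k = q" | "k = r" | "k = j" by blast
  then show ?thesis
  proof cases
    case 1
    show ?thesis
    proof (rule dominatedI[of q r j k])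
      show "UNIV = {q, r, j, k}" using U 1 by (simp add: insert_commute)
    qed (use ne w 1 in \<open>simp_all add: apollonian_gen_nth s rec\<close>)
  next
    case 2
    show ?thesis
    proof (rule dominatedI[of p r j k])
      show "UNIV = {p, r, j, k}" using U 2 by (simp add: insert_commute)
    qed (use ne w 2 in \<open>simp_all add: apollonian_gen_nth s rec\<close>)
  next
    case 3
    show ?thesis
    proof (rule dominatedI[of p q j k])
      show "UNIV = {p, q, j, k}" using U 3 by (simp add: insert_commute)
    qed (use ne w 3 in \<open>simp_all add: apollonian_gen_nth s rec\<close>)
  next
    case 4
    then have max: "w $ j \<le> w $ p + w $ q + w $ r" using k s by simp
    show ?thesis
    proof (rule dominatedI[of p q r k])
      show "UNIV = {p, q, r, k}" using U 4 by (simp add: insert_commute)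
    qed (use ne w max 4 in \<open>simp_all add: apollonian_gen_nth s rec\<close>)
  qed
qed

text \<open>Putting \<open>j\<close> in front of the word says that its first letter avoids the
  largest entry; each later letter then avoids the entry just created.\<close>

lemma dominated_word_matrix:
  assumes "\<And>n. u (Suc (Suc (Suc (Suc n)))) =
      2 * (u (Suc n) + u (Suc (Suc n)) + u (Suc (Suc (Suc n)))) - u n"
    and "dominated u n j w" and "distinct_adj (j # is)"
  shows "\<exists>k. dominated u (n + length is) k (word_matrix is *v w)"
  using assms(2,3)
proof (induction "is" arbitrary: n j w)
  case Nil
  then show ?case by auto
next
  case (Cons i "is")
  have "dominated u (Suc n) i (apollonian_gen i *v w)"
    by (rule dominated_step[OF Cons.prems(1) assms(1)]) (use Cons.prems(2) in auto)
  moreover have "distinct_adj (i # is)" using Cons.prems(2) by simp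
  ultimately show ?case
    using Cons.IH by (fastforce simp: matrix_vector_mul_assoc)
qed

theorem theorem7p1:
  fixes a b c d :: real and v :: "real ^ 4" and n :: nat and W :: "real ^ 4 ^ 4"
  assumes "v = vector [a, b, c, d]"
    and "root_quadruple v"
    and "a \<le> b" and "b \<le> c" and "c \<le> d"
    and "a < 0"
    and "a + b + c + d > 0"
    and "reduced_word n W"
  shows "infnorm (W *v v) \<le> infnorm (T_word n *v v)"
proof -
  have root: "v $ 1 \<le> 0" "0 \<le> v $ 2" "v $ 2 \<le> v $ 3" "v $ 3 \<le> v $ 4"
    "v $ 4 \<le> v $ 1 + v $ 2 + v $ 3"
    using assms(2) by (auto simp: root_quadruple_def)
  \<comment> \<open>Here the difference is zero, and \<open>0 \<le> v $ 1 + v $ 2\<close> follows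
    from \<open>v $ 3 \<le> v $ 4 \<le> v $ 1 + v $ 2 + v $ 3\<close>.\<close>
  have base: "dominated (greedy_seq v) 0 4 v"
    by (rule dominatedI[of 1 2 3]) (use root UNIV_4 in \<open>simp_all add: numeral_eq_Suc\<close>)
  obtain "is" where len: "length is = n" and W: "W = word_matrix is"
    and adj: "\<forall>k. Suc k < n \<longrightarrow> is ! k \<noteq> is ! Suc k"
    using assms(8) by (auto simp: reduced_word_def)
  have "\<exists>k. dominated (greedy_seq v) n k (W *v v)"
  proof (cases "is")
    case Nil
    then show ?thesis using len W base by auto
  next
    case (Cons i js)
    \<comment> \<open>The first letter is unrestricted and may be 4, the index of the largest entry;
      the root condition covers that case.\<close>
    have "2 * v $ 4 \<le> (\<Sum>i\<in>UNIV. v $ i)" using root by (simp add: sum_4)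
    then have "dominated (greedy_seq v) (Suc 0) i (apollonian_gen i *v v)"
      by (intro dominated_step[OF base]) simp_all
    moreover have "distinct_adj (i # js)"
      using adj len Cons by (auto simp: distinct_adj_conv_nth)
    ultimately have "\<exists>k. dominated (greedy_seq v) (Suc 0 + length js) k
        (word_matrix js *v (apollonian_gen i *v v))"
      by (intro dominated_word_matrix) simp_all
    then show ?thesis using len W Cons by (simp add: matrix_vector_mul_assoc)
  qed
  then show ?thesis using dominated_infnorm greedy_seq_le_infnorm_T_word order_trans by blast
qed

end
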